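(* Let $p$ be a prime, $\nu\in\mathbb{Z}$, $z\in\mathbb{Q}_{p}$. The limit $\mu_p(z,\nu)=\lim_{n\to\infty}F_n(z,\nu)$ is given as follows. (1) If $z$ is a $p$-adic integer, and either $z\ne 0$ and $\mathrm{ord}_{p}(z)<\nu$, or $z=0$ and $\nu\ge 1$, then $$\mu_p(z,\nu)=\frac{1}{p^{\nu}+p^{\nu-1}}.$$ (2) If $z$ is not a $p$-adic integer, $\mathrm{ord}_{p}(z)=-\lambda<0$, and $\mathrm{ord}_p(z)<\nu$, then $$\mu_p(z,\nu)=\frac{1}{p^{\nu+2\lambda}+p^{\nu+2\lambda-1}}.$$ (3) If $z=0$ and $-\nu\le 0$, then $$\mu_p(0,-\nu)=1-\frac{1}{p^{\nu+1}+p^{\nu}}.$$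
   Context: The Calkin–Wilf tree $\mathcal{T}$ is the binary tree with root $\frac{1}{1}$ in which each fraction $\frac{a}{b}$ has the two children $\frac{a}{a+b}$ and $\frac{a+b}{b}$. Its $n$th generation $\mathcal{T}^{(n)}$ ($n\ge 1$, $\mathcal{T}^{(1)}=\{\frac11\}$) consists of $2^{n-1}$ distinct positive rationals. For a prime $p$, $z\in\mathbb{Q}_p$, $\nu\in\mathbb{Z}$, $$F_{n}(z,\nu)=2^{-n+1}\,\#\left\{\tfrac{a}{b}\in\mathcal{T}^{(n)}:\ \mathrm{ord}_{p}\left(\tfrac{a}{b}-z\right)\ge\nu\right\},$$ where $\mathrm{ord}_p$ is the $p$-adic valuation, $\mathrm{ord}_p(0)=+\infty$. *)

theory Defs
  imports Complex_Main "HOL-Computational_Algebra.Primes" "HOL-Library.Extended"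
    "HOL-Algebra.QuotRing"
begin

section \<open>The \<open>p\<close>-adic valuation on the rationals\<close>

definition rat_ord :: "nat \<Rightarrow> rat \<Rightarrow> int extended" where
  "rat_ord p q = (if q = 0 then Pinf else
     case quotient_of q of (a, b) \<Rightarrow>
       Fin (int (multiplicity (int p) a) - int (multiplicity (int p) b)))"

lemma rat_ord_0 [simp]: "rat_ord p 0 = Pinf"
  by (simp add: rat_ord_def)

lemma rat_ord_neq_Minf [simp]: "rat_ord p q \<noteq> Minf"
  by (simp add: rat_ord_def split: prod.split)

lemma rat_ord_eq_Pinf_iff [simp]: "rat_ord p q = Pinf \<longleftrightarrow> q = 0"
  by (simp add: rat_ord_def split: prod.split)

text \<open>The representation of a rational as a fraction does not matter.\<close>

lemma rat_ord_divide:
  assumes "prime p" "a \<noteq> 0" "b \<noteq> 0"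
  shows "rat_ord p (of_int a / of_int b) =
    Fin (int (multiplicity (int p) a) - int (multiplicity (int p) b))"
proof -
  define q :: rat where "q = of_int a / of_int b"
  obtain c d where cd: "quotient_of q = (c, d)" by force
  have d: "d > 0" using quotient_of_denom_pos[OF cd] .
  have q: "q = of_int c / of_int d" using quotient_of_div[OF cd] .
  have q0: "q \<noteq> 0" using assms by (simp add: q_def)
  hence c: "c \<noteq> 0" using q by auto
  have "(of_int (a * d) :: rat) = of_int (c * b)"
    using q d assms by (simp add: q_def field_simps)
  hence eq: "a * d = c * b" using of_int_eq_iff by blast
  have pe: "prime_elem (int p)" using assms(1) by simp
  have "multiplicity (int p) a + multiplicity (int p) d
      = multiplicity (int p) c + multiplicity (int p) b"
    using arg_cong[OF eq, of "multiplicity (int p)"] assms c d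
    by (simp add: prime_elem_multiplicity_mult_distrib[OF pe])
  thus ?thesis using q0 cd unfolding q_def[symmetric] rat_ord_def by simp
qed

lemma rat_fractionE:
  fixes x y :: rat
  obtains a b d :: int where "d \<noteq> 0" "x = of_int a / of_int d" "y = of_int b / of_int d"
proof -
  obtain a c where x: "quotient_of x = (a, c)" by force
  obtain b e where y: "quotient_of y = (b, e)" by force
  have "c > 0" "e > 0" using quotient_of_denom_pos x y by auto
  thus thesis using that[of "c * e" "a * e" "b * c"] quotient_of_div[OF x] quotient_of_div[OF y]
    by simp
qed

lemma rat_ord_1 [simp]: "prime p \<Longrightarrow> rat_ord p 1 = Fin 0"
  using rat_ord_divide[of p 1 1] by simp

lemma rat_ord_mult:
  assumes "prime p"
  shows "rat_ord p (x * y) = rat_ord p x + rat_ord p y"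
proof (cases "x = 0 \<or> y = 0")
  case True
  thus ?thesis by (cases "rat_ord p x"; cases "rat_ord p y") auto
next
  case False
  obtain a b d where ab: "d \<noteq> 0" "x = of_int a / of_int d" "y = of_int b / of_int d"
    by (rule rat_fractionE)
  have nz: "a \<noteq> 0" "b \<noteq> 0" using False ab by auto
  have pe: "prime_elem (int p)" using assms by simp
  have "x * y = of_int (a * b) / of_int (d * d)" using ab by simp
  hence "rat_ord p (x * y) =
      Fin (int (multiplicity (int p) (a * b)) - int (multiplicity (int p) (d * d)))"
    using rat_ord_divide[OF assms, of "a * b" "d * d"] nz ab(1) by simp
  thus ?thesis
    using ab nz rat_ord_divide[OF assms]
    by (simp add: prime_elem_multiplicity_mult_distrib[OF pe])
qed

lemma rat_ord_uminus:
  assumes "prime p"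
  shows "rat_ord p (- x) = rat_ord p x"
proof -
  have "rat_ord p (- 1) = Fin 0"
    using rat_ord_divide[OF assms, of "-1" 1] by (simp add: multiplicity_unit_right)
  thus ?thesis using rat_ord_mult[OF assms, of "- 1" x] by (cases "rat_ord p x") auto
qed

lemma rat_ord_add_ge:
  assumes p: "prime p" and k: "Fin k \<le> rat_ord p x" "Fin k \<le> rat_ord p y"
  shows "Fin k \<le> rat_ord p (x + y)"
proof (cases "x = 0 \<or> y = 0 \<or> x + y = 0")
  case True
  thus ?thesis using k by auto
next
  case False
  obtain a b d where ab: "d \<noteq> 0" "x = of_int a / of_int d" "y = of_int b / of_int d"
    by (rule rat_fractionE)
  have xy: "x + y = of_int (a + b) / of_int d" using ab by (simp add: add_divide_distrib)
  have nz: "a \<noteq> 0" "b \<noteq> 0" "a + b \<noteq> 0" using False ab xy by auto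
  define m where "m = min (multiplicity (int p) a) (multiplicity (int p) b)"
  have "int p ^ m dvd a + b"
    by (intro dvd_add) (auto simp: m_def intro: multiplicity_dvd')
  hence "m \<le> multiplicity (int p) (a + b)"
    using nz p prime_ge_2_nat[OF p] by (intro multiplicity_geI) auto
  thus ?thesis
    using k nz(1,2) unfolding xy unfolding ab(2,3) rat_ord_divide[OF p nz(3) ab(1)]
      rat_ord_divide[OF p nz(1) ab(1)] rat_ord_divide[OF p nz(2) ab(1)]
    by (auto simp: m_def min_def split: if_splits)
qed

lemma rat_ord_diff_ge:
  assumes "prime p" "Fin k \<le> rat_ord p x" "Fin k \<le> rat_ord p y"
  shows "Fin k \<le> rat_ord p (x - y)"
  using rat_ord_add_ge[of p k x "- y"] assms by (simp add: rat_ord_uminus)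

lemma rat_ord_eqI:
  assumes p: "prime p" and x: "rat_ord p x = Fin v" and xy: "Fin (v + 1) \<le> rat_ord p (x - y)"
  shows "rat_ord p y = Fin v"
proof -
  have "Fin v \<le> rat_ord p (x - y)" using xy by (cases "rat_ord p (x - y)") auto
  hence ge: "Fin v \<le> rat_ord p y"
    using rat_ord_diff_ge[OF p, of v x "x - y"] x by simp
  have "\<not> Fin (v + 1) \<le> rat_ord p y"
    using rat_ord_add_ge[OF p, of "v + 1" "x - y" y] xy x by auto
  thus ?thesis using ge by (cases "rat_ord p y") auto
qed


section \<open>The field of \<open>p\<close>-adic numbers\<close>

text \<open>\<open>\<rat>\<^sub>p\<close> is the completion of \<open>\<rat>\<close>: rational Cauchy sequences modulo null sequences,
  both with respect to the \<open>p\<close>-adic valuation.\<close>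

definition padic_cauchy :: "nat \<Rightarrow> (nat \<Rightarrow> rat) \<Rightarrow> bool" where
  "padic_cauchy p s \<longleftrightarrow> (\<forall>k. \<exists>N. \<forall>m\<ge>N. \<forall>n\<ge>N. Fin k \<le> rat_ord p (s m - s n))"

definition padic_null :: "nat \<Rightarrow> (nat \<Rightarrow> rat) set" where
  "padic_null p = {s. \<forall>k. \<exists>N. \<forall>n\<ge>N. Fin k \<le> rat_ord p (s n)}"

definition cauchy_ring :: "nat \<Rightarrow> (nat \<Rightarrow> rat) ring" where
  "cauchy_ring p = \<lparr>carrier = {s. padic_cauchy p s},
     mult = (\<lambda>s t n. s n * t n), one = (\<lambda>n. 1),
     zero = (\<lambda>n. 0), add = (\<lambda>s t n. s n + t n)\<rparr>"

definition Qp :: "nat \<Rightarrow> (nat \<Rightarrow> rat) set ring" where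
  "Qp p = cauchy_ring p Quot padic_null p"

definition padic_of_rat :: "nat \<Rightarrow> rat \<Rightarrow> (nat \<Rightarrow> rat) set" where
  "padic_of_rat p q = padic_null p +>\<^bsub>cauchy_ring p\<^esub> (\<lambda>n. q)"

text \<open>The valuation of a nonzero \<open>p\<close>-adic number is the eventually constant valuation of
  any sequence representing it; see \<open>padic_ord_coset\<close> below.\<close>

definition padic_ord :: "nat \<Rightarrow> (nat \<Rightarrow> rat) set \<Rightarrow> int extended" where
  "padic_ord p z = (if z = \<zero>\<^bsub>Qp p\<^esub> then Pinf else
     THE v. \<forall>s\<in>z. \<forall>\<^sub>F n in sequentially. rat_ord p (s n) = v)"

definition padic_integers :: "nat \<Rightarrow> (nat \<Rightarrow> rat) set set" where
  "padic_integers p = {z \<in> carrier (Qp p). 0 \<le> padic_ord p z}"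


subsection \<open>Well-definedness\<close>

lemma padic_null_imp_cauchy:
  assumes "prime p" "s \<in> padic_null p"
  shows "padic_cauchy p s"
  unfolding padic_cauchy_def
proof
  fix k
  obtain N where "\<forall>n\<ge>N. Fin k \<le> rat_ord p (s n)"
    using assms(2) by (auto simp: padic_null_def)
  thus "\<exists>N. \<forall>m\<ge>N. \<forall>n\<ge>N. Fin k \<le> rat_ord p (s m - s n)"
    using rat_ord_diff_ge[OF assms(1)] by blast
qed

lemma padic_cauchy_const: "padic_cauchy p (\<lambda>n. q)"
  by (simp add: padic_cauchy_def)

lemma padic_cauchy_add:
  assumes p: "prime p" and s: "padic_cauchy p s" and t: "padic_cauchy p t"
  shows "padic_cauchy p (\<lambda>n. s n + t n)"
  unfolding padic_cauchy_def
proof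
  fix k
  obtain M N where MN: "\<forall>m\<ge>M. \<forall>n\<ge>M. Fin k \<le> rat_ord p (s m - s n)"
    "\<forall>m\<ge>N. \<forall>n\<ge>N. Fin k \<le> rat_ord p (t m - t n)"
    using s t unfolding padic_cauchy_def by meson
  have "Fin k \<le> rat_ord p ((s m + t m) - (s n + t n))" if "m \<ge> max M N" "n \<ge> max M N" for m n
    using rat_ord_add_ge[OF p, of k "s m - s n" "t m - t n"] MN that
    by (simp add: algebra_simps)
  thus "\<exists>N. \<forall>m\<ge>N. \<forall>n\<ge>N. Fin k \<le> rat_ord p ((s m + t m) - (s n + t n))" by blast
qed

lemma padic_cauchy_bounded:
  assumes p: "prime p" and s: "padic_cauchy p s"
  obtains b N where "\<And>n. n \<ge> N \<Longrightarrow> Fin b \<le> rat_ord p (s n)"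
proof -
  obtain N where N: "\<forall>m\<ge>N. \<forall>n\<ge>N. Fin 0 \<le> rat_ord p (s m - s n)"
    using s unfolding padic_cauchy_def by blast
  obtain b where b: "Fin b \<le> rat_ord p (s N)" "b \<le> 0"
  proof (cases "rat_ord p (s N)")
    case (Fin v)
    thus thesis using that[of "min v 0"] by simp
  qed (use that[of 0] in auto)
  have "Fin b \<le> rat_ord p (s n)" if "n \<ge> N" for n
  proof -
    have "Fin 0 \<le> rat_ord p (s n - s N)" using N that by simp
    hence "Fin b \<le> rat_ord p (s n - s N)"
      using b(2) by (cases "rat_ord p (s n - s N)") auto
    thus ?thesis using rat_ord_add_ge[OF p _ b(1), of "s n - s N"] by simp
  qed
  thus thesis using that by blast
qed

lemma rat_ord_mult_ge:
  assumes "prime p" "Fin k \<le> rat_ord p x" "Fin l \<le> rat_ord p y"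
  shows "Fin (k + l) \<le> rat_ord p (x * y)"
  using assms by (cases "rat_ord p x"; cases "rat_ord p y") (auto simp: rat_ord_mult)

lemma padic_cauchy_mult:
  assumes p: "prime p" and s: "padic_cauchy p s" and t: "padic_cauchy p t"
  shows "padic_cauchy p (\<lambda>n. s n * t n)"
  unfolding padic_cauchy_def
proof
  fix k
  obtain b B where b: "\<And>n. n \<ge> B \<Longrightarrow> Fin b \<le> rat_ord p (s n)"
    using padic_cauchy_bounded[OF p s] by blast
  obtain c C where c: "\<And>n. n \<ge> C \<Longrightarrow> Fin c \<le> rat_ord p (t n)"
    using padic_cauchy_bounded[OF p t] by blast
  obtain M N where MN: "\<forall>m\<ge>M. \<forall>n\<ge>M. Fin (k - c) \<le> rat_ord p (s m - s n)"
    "\<forall>m\<ge>N. \<forall>n\<ge>N. Fin (k - b) \<le> rat_ord p (t m - t n)"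
    using s t unfolding padic_cauchy_def by meson
  have "Fin k \<le> rat_ord p (s m * t m - s n * t n)"
    if "m \<ge> Max {B, C, M, N}" "n \<ge> Max {B, C, M, N}" for m n
  proof -
    have "Fin (k - c) \<le> rat_ord p (s m - s n)" "Fin (k - b) \<le> rat_ord p (t m - t n)"
      using MN that by auto
    hence "Fin (k - c + c) \<le> rat_ord p ((s m - s n) * t m)"
      "Fin (b + (k - b)) \<le> rat_ord p (s n * (t m - t n))"
      using b[of n] c[of m] that by (intro rat_ord_mult_ge[OF p]; simp)+
    thus ?thesis
      using rat_ord_add_ge[OF p, of k "(s m - s n) * t m" "s n * (t m - t n)"]
      by (simp add: algebra_simps)
  qed
  thus "\<exists>N. \<forall>m\<ge>N. \<forall>n\<ge>N. Fin k \<le> rat_ord p (s m * t m - s n * t n)" by blast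
qed

lemma cauchy_ring_cring:
  assumes "prime p"
  shows "cring (cauchy_ring p)"
proof (rule cringI)
  show "abelian_group (cauchy_ring p)"
  proof (rule abelian_groupI)
    fix s assume "s \<in> carrier (cauchy_ring p)"
    hence "padic_cauchy p (\<lambda>n. - 1 * s n)"
      by (intro padic_cauchy_mult[OF assms] padic_cauchy_const) (simp add: cauchy_ring_def)
    thus "\<exists>t\<in>carrier (cauchy_ring p). t \<oplus>\<^bsub>cauchy_ring p\<^esub> s = \<zero>\<^bsub>cauchy_ring p\<^esub>"
      by (intro bexI[of _ "\<lambda>n. - 1 * s n"]) (auto simp: cauchy_ring_def)
  qed (auto simp: cauchy_ring_def padic_cauchy_add[OF assms] padic_cauchy_const algebra_simps)
  show "comm_monoid (cauchy_ring p)"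
    by (rule comm_monoidI)
      (auto simp: cauchy_ring_def padic_cauchy_mult[OF assms] padic_cauchy_const algebra_simps)
qed (auto simp: cauchy_ring_def algebra_simps)

lemma padic_null_ideal:
  assumes p: "prime p"
  shows "ideal (padic_null p) (cauchy_ring p)"
proof -
  interpret cring "cauchy_ring p" using cauchy_ring_cring[OF p] .
  have mult: "(\<lambda>n. s n * t n) \<in> padic_null p"
    if s: "s \<in> padic_null p" and t: "padic_cauchy p t" for s t
    unfolding padic_null_def
  proof (intro CollectI allI)
    fix k
    obtain c C where c: "\<And>n. n \<ge> C \<Longrightarrow> Fin c \<le> rat_ord p (t n)"
      using padic_cauchy_bounded[OF p t] by blast
    obtain N where N: "\<forall>n\<ge>N. Fin (k - c) \<le> rat_ord p (s n)"
      using s by (auto simp: padic_null_def)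
    have "Fin k \<le> rat_ord p (s n * t n)" if "n \<ge> max C N" for n
      using rat_ord_mult_ge[OF p, of "k - c" "s n" c "t n"] N c that by simp
    thus "\<exists>N. \<forall>n\<ge>N. Fin k \<le> rat_ord p (s n * t n)" by blast
  qed
  have add: "(\<lambda>n. s n + t n) \<in> padic_null p" if st: "s \<in> padic_null p" "t \<in> padic_null p" for s t
    unfolding padic_null_def
  proof (intro CollectI allI)
    fix k
    obtain M N where "\<forall>n\<ge>M. Fin k \<le> rat_ord p (s n)" "\<forall>n\<ge>N. Fin k \<le> rat_ord p (t n)"
      using st unfolding padic_null_def by blast
    hence "Fin k \<le> rat_ord p (s n + t n)" if "n \<ge> max M N" for n
      using that by (intro rat_ord_add_ge[OF p]) auto
    thus "\<exists>N. \<forall>n\<ge>N. Fin k \<le> rat_ord p (s n + t n)" by blast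
  qed
  show ?thesis
  proof (rule idealI)
    show "subgroup (padic_null p) (add_monoid (cauchy_ring p))"
    proof (rule add.subgroupI)
      show "padic_null p \<subseteq> carrier (cauchy_ring p)"
        using padic_null_imp_cauchy[OF p] by (auto simp: cauchy_ring_def)
      have "(\<lambda>n. 0) \<in> padic_null p" by (simp add: padic_null_def)
      thus "padic_null p \<noteq> {}" by blast
      fix s assume s: "s \<in> padic_null p"
      have m: "(\<lambda>n. s n * - 1) \<in> padic_null p"
        using mult[OF s padic_cauchy_const] .
      have "\<ominus>\<^bsub>cauchy_ring p\<^esub> s = (\<lambda>n. s n * - 1)"
        using s m padic_null_imp_cauchy[OF p]
        by (intro minus_equality) (auto simp: cauchy_ring_def)
      thus "\<ominus>\<^bsub>cauchy_ring p\<^esub> s \<in> padic_null p" using m by simp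
      fix t assume "t \<in> padic_null p"
      thus "s \<oplus>\<^bsub>cauchy_ring p\<^esub> t \<in> padic_null p" using add s by (simp add: cauchy_ring_def)
    qed
  next
    fix s t assume "s \<in> padic_null p" "t \<in> carrier (cauchy_ring p)"
    thus "s \<otimes>\<^bsub>cauchy_ring p\<^esub> t \<in> padic_null p" "t \<otimes>\<^bsub>cauchy_ring p\<^esub> s \<in> padic_null p"
      using mult by (simp_all add: cauchy_ring_def mult.commute)
  qed (rule ring_axioms)
qed

lemma rat_ord_eventually_const:
  assumes p: "prime p" and s: "padic_cauchy p s" and nn: "s \<notin> padic_null p"
  obtains v N where "\<And>n. n \<ge> N \<Longrightarrow> rat_ord p (s n) = Fin v"
proof -
  obtain k where k: "\<And>N. \<exists>n\<ge>N. \<not> Fin k \<le> rat_ord p (s n)"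
    using nn by (auto simp: padic_null_def)
  obtain N where N: "\<forall>m\<ge>N. \<forall>n\<ge>N. Fin k \<le> rat_ord p (s m - s n)"
    using s unfolding padic_cauchy_def by blast
  obtain m where m: "m \<ge> N" "\<not> Fin k \<le> rat_ord p (s m)" using k by blast
  then obtain v where v: "rat_ord p (s m) = Fin v" "v < k"
    by (cases "rat_ord p (s m)") auto
  have "rat_ord p (s n) = Fin v" if "n \<ge> N" for n
  proof -
    have "Fin k \<le> rat_ord p (s m - s n)" using N m that by blast
    hence "Fin (v + 1) \<le> rat_ord p (s m - s n)"
      using v(2) by (cases "rat_ord p (s m - s n)") auto
    thus ?thesis by (rule rat_ord_eqI[OF p v(1)])
  qed
  thus thesis using that by blast
qed

lemma Qp_zero: "\<zero>\<^bsub>Qp p\<^esub> = padic_null p"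
  by (simp add: Qp_def FactRing_def)

lemma Qp_coset_eq_zero_iff:
  assumes "prime p" "padic_cauchy p s"
  shows "padic_null p +>\<^bsub>cauchy_ring p\<^esub> s = \<zero>\<^bsub>Qp p\<^esub> \<longleftrightarrow> s \<in> padic_null p"
proof -
  interpret ideal "padic_null p" "cauchy_ring p" using padic_null_ideal[OF assms(1)] .
  show ?thesis
    using assms(2) a_rcos_const[of s] rcos_const_imp_mem[of s]
    by (auto simp: Qp_zero cauchy_ring_def)
qed

lemma Qp_carrier:
  "carrier (Qp p) = {padic_null p +>\<^bsub>cauchy_ring p\<^esub> s |s. padic_cauchy p s}"
  by (auto simp: Qp_def FactRing_def A_RCOSETS_def' cauchy_ring_def)

lemma padic_ord_zero [simp]: "padic_ord p \<zero>\<^bsub>Qp p\<^esub> = Pinf"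
  by (simp add: padic_ord_def)

lemma padic_ord_coset:
  assumes p: "prime p" and s: "padic_cauchy p s" and nn: "s \<notin> padic_null p"
  shows "\<forall>\<^sub>F n in sequentially.
    rat_ord p (s n) = padic_ord p (padic_null p +>\<^bsub>cauchy_ring p\<^esub> s)"
    and "padic_ord p (padic_null p +>\<^bsub>cauchy_ring p\<^esub> s) \<noteq> Pinf"
proof -
  let ?z = "padic_null p +>\<^bsub>cauchy_ring p\<^esub> s"
  obtain v N where v: "\<And>n. n \<ge> N \<Longrightarrow> rat_ord p (s n) = Fin v"
    using rat_ord_eventually_const[OF assms] by blast
  have all: "\<forall>\<^sub>F n in sequentially. rat_ord p (t n) = Fin v" if t: "t \<in> ?z" for t
  proof -
    obtain h where h: "h \<in> padic_null p" "t = (\<lambda>n. h n + s n)"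
      using t by (auto simp: a_r_coset_def' cauchy_ring_def)
    obtain M where M: "\<forall>n\<ge>M. Fin (v + 1) \<le> rat_ord p (h n)"
      using h(1) by (auto simp: padic_null_def)
    have "rat_ord p (t n) = Fin v" if "n \<ge> max M N" for n
    proof (rule rat_ord_eqI[OF p])
      show "rat_ord p (s n) = Fin v" using v that by simp
      have "s n - t n = - h n" using h by simp
      thus "Fin (v + 1) \<le> rat_ord p (s n - t n)" using M that by (simp add: rat_ord_uminus[OF p])
    qed
    thus ?thesis unfolding eventually_sequentially by blast
  qed
  have "(\<lambda>n. 0) \<in> padic_null p" by (simp add: padic_null_def)
  hence sz: "s \<in> ?z" by (force simp: a_r_coset_def' cauchy_ring_def)
  have "(THE w. \<forall>t\<in>?z. \<forall>\<^sub>F n in sequentially. rat_ord p (t n) = w) = Fin v"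
  proof (rule the_equality)
    fix w assume "\<forall>t\<in>?z. \<forall>\<^sub>F n in sequentially. rat_ord p (t n) = w"
    hence "\<forall>\<^sub>F n in sequentially. rat_ord p (s n) = w" using sz by blast
    with all[OF sz] have "\<forall>\<^sub>F n::nat in sequentially. Fin v = w"
      by eventually_elim simp
    thus "w = Fin v" by simp
  qed (use all in blast)
  hence ord: "padic_ord p ?z = Fin v"
    using Qp_coset_eq_zero_iff[OF p s] nn by (simp add: padic_ord_def)
  show "\<forall>\<^sub>F n in sequentially. rat_ord p (s n) = padic_ord p ?z"
    using all[OF sz] ord by simp
  show "padic_ord p ?z \<noteq> Pinf" using ord by simp
qed

lemma padic_ord_of_rat:
  assumes p: "prime p"
  shows "padic_ord p (padic_of_rat p q) = rat_ord p q"
proof (cases "q = 0")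
  case True
  hence "(\<lambda>n. q) \<in> padic_null p" by (simp add: padic_null_def)
  thus ?thesis using True Qp_coset_eq_zero_iff[OF p padic_cauchy_const, of q]
    by (simp add: padic_of_rat_def)
next
  case False
  then obtain v where v: "rat_ord p q = Fin v" by (cases "rat_ord p q") auto
  hence "(\<lambda>n. q) \<notin> padic_null p"
    by (auto simp: padic_null_def intro!: exI[of _ "v + 1"])
  from padic_ord_coset(1)[OF p padic_cauchy_const this] show ?thesis
    by (simp add: padic_of_rat_def)
qed

theorem Qp_field:
  assumes p: "prime p"
  shows "field (Qp p)"
proof -
  interpret ideal "padic_null p" "cauchy_ring p" using padic_null_ideal[OF p] .
  have cr: "cring (Qp p)"
    unfolding Qp_def using quotient_is_cring[OF cauchy_ring_cring[OF p]] .
  have one: "\<one>\<^bsub>Qp p\<^esub> = padic_null p +>\<^bsub>cauchy_ring p\<^esub> (\<lambda>n. 1)"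
    by (simp add: Qp_def FactRing_def cauchy_ring_def)
  show ?thesis
  proof (rule cring.cring_fieldI2[OF cr])
    have "padic_ord p \<one>\<^bsub>Qp p\<^esub> = Fin 0"
      using padic_ord_of_rat[OF p, of 1] p by (simp add: one padic_of_rat_def)
    thus "\<zero>\<^bsub>Qp p\<^esub> \<noteq> \<one>\<^bsub>Qp p\<^esub>" by (metis padic_ord_zero extended.distinct(1))
  next
    fix z assume "z \<in> carrier (Qp p)" and nz: "z \<noteq> \<zero>\<^bsub>Qp p\<^esub>"
    then obtain s where s: "padic_cauchy p s" and z: "z = padic_null p +>\<^bsub>cauchy_ring p\<^esub> s"
      by (auto simp: Qp_carrier)
    have nn: "s \<notin> padic_null p" using nz Qp_coset_eq_zero_iff[OF p s] z by simp
    obtain v N where v: "\<And>n. n \<ge> N \<Longrightarrow> rat_ord p (s n) = Fin v"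
      using rat_ord_eventually_const[OF p s nn] by blast
    have s0: "s n \<noteq> 0" if "n \<ge> N" for n using v[OF that] by auto
    have inv: "rat_ord p (inverse (s n)) = Fin (- v)" if "n \<ge> N" for n
      using rat_ord_mult[OF p, of "s n" "inverse (s n)"] v[OF that] s0[OF that] p
      by (cases "rat_ord p (inverse (s n))") auto
    define t where "t = (\<lambda>n. inverse (s n))"
    have t: "padic_cauchy p t"
      unfolding padic_cauchy_def
    proof
      fix k
      obtain M where M: "\<forall>m\<ge>M. \<forall>n\<ge>M. Fin (k + 2 * v) \<le> rat_ord p (s m - s n)"
        using s unfolding padic_cauchy_def by blast
      have "Fin k \<le> rat_ord p (t m - t n)" if mn: "m \<ge> max M N" "n \<ge> max M N" for m n
      proof -
        have "t m - t n = (s n - s m) * (inverse (s m) * inverse (s n))"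
          using s0[of m] s0[of n] mn by (simp add: t_def field_simps)
        moreover have "Fin (- v + - v) \<le> rat_ord p (inverse (s m) * inverse (s n))"
          using inv mn by (intro rat_ord_mult_ge[OF p]) auto
        moreover have "Fin (k + 2 * v) \<le> rat_ord p (s n - s m)" using M mn by simp
        ultimately show ?thesis
          using rat_ord_mult_ge[OF p, of "k + 2 * v" "s n - s m" "- v + - v"] by simp
      qed
      thus "\<exists>N. \<forall>m\<ge>N. \<forall>n\<ge>N. Fin k \<le> rat_ord p (t m - t n)" by blast
    qed
    have "(\<lambda>n. s n * t n + - 1 * 1) \<in> padic_null p"
      unfolding padic_null_def
      by (intro CollectI allI exI[of _ N]) (auto simp: t_def s0)
    hence "(\<lambda>n. s n * t n) \<in> padic_null p +>\<^bsub>cauchy_ring p\<^esub> (\<lambda>n. 1)"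
      by (auto simp: a_r_coset_def' cauchy_ring_def intro!: bexI)
    hence "padic_null p +>\<^bsub>cauchy_ring p\<^esub> (\<lambda>n. 1) = padic_null p +>\<^bsub>cauchy_ring p\<^esub> (\<lambda>n. s n * t n)"
      by (intro a_repr_independence a_subgroup)
        (auto simp: cauchy_ring_def padic_cauchy_const)
    moreover have "z \<otimes>\<^bsub>Qp p\<^esub> (padic_null p +>\<^bsub>cauchy_ring p\<^esub> t)
        = padic_null p +>\<^bsub>cauchy_ring p\<^esub> (\<lambda>n. s n * t n)"
      using rcoset_mult_add[of s t] s t by (simp add: z Qp_def FactRing_def cauchy_ring_def)
    ultimately show "\<exists>w\<in>carrier (Qp p). z \<otimes>\<^bsub>Qp p\<^esub> w = \<one>\<^bsub>Qp p\<^esub>"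
      using t one by (intro bexI[of _ "padic_null p +>\<^bsub>cauchy_ring p\<^esub> t"]) (auto simp: Qp_carrier)
  qed
qed


section \<open>The Calkin--Wilf tree\<close>

text \<open>Fractions \<open>a/b\<close> are pairs \<open>(a, b)\<close>; generations are numbered from \<open>1\<close>.\<close>

fun cw_fractions :: "nat \<Rightarrow> (nat \<times> nat) set" where
  "cw_fractions 0 = {}"
| "cw_fractions (Suc 0) = {(1, 1)}"
| "cw_fractions (Suc (Suc n)) =
     (\<Union>(a, b)\<in>cw_fractions (Suc n). {(a, a + b), (a + b, b)})"

definition cw_generation :: "nat \<Rightarrow> rat set" where
  "cw_generation n = (\<lambda>(a, b). of_nat a / of_nat b) ` cw_fractions n"

definition cw_F :: "nat \<Rightarrow> nat \<Rightarrow> (nat \<Rightarrow> rat) set \<Rightarrow> int \<Rightarrow> real" where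
  "cw_F p n z \<nu> = 2 powi (- int n + 1) *
     real (card {q \<in> cw_generation n. Fin \<nu> \<le> padic_ord p (padic_of_rat p q \<ominus>\<^bsub>Qp p\<^esub> z)})"

definition cw_mu :: "nat \<Rightarrow> (nat \<Rightarrow> rat) set \<Rightarrow> int \<Rightarrow> real" where
  "cw_mu p z \<nu> = lim (\<lambda>n. cw_F p n z \<nu>)"

end

theory Submission
  imports Defs "HOL-Number_Theory.Cong"
begin

text \<open>Modulo \<open>N = p\<^sup>k\<close>, passing to a random child of \<open>a/b\<close> is a random walk on the primitive vectors
  \<open>(a, b)\<close>, driven by two permutations. The state \<open>(0, 1)\<close> is fixed by the left child map and can be
  reached from everywhere, so the walk equidistributes. Of the \<open>N\<^sup>2 - (N/p)\<^sup>2\<close> primitive vectors,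
  \<open>N - N/p\<close> lie on the line \<open>a = c b\<close>, which gives the limit for \<open>p\<close>-adic integers \<open>z\<close> with
  \<open>c\<close> approximating \<open>z\<close>. The tree is invariant under \<open>q \<mapsto> 1/q\<close>. For \<open>ord z = -l < 0\<close>, the condition
  \<open>ord (q - z) \<ge> \<nu>\<close> becomes \<open>ord (1/q - 1/z) \<ge> \<nu> + 2l\<close>, and \<open>ord q \<ge> -\<nu>\<close> is the negation of
  \<open>ord (1/q) \<ge> \<nu> + 1\<close>.\<close>

section \<open>Random walks generated by two permutations\<close>

text \<open>This is the transition operator of the walk acting on functions: its \<open>n\<close>-th
  iterate applied to \<open>h\<close> gives at \<open>x\<close> the expectation of \<open>h\<close>
  after \<open>n\<close> random steps from \<open>x\<close>.\<close>

definition walk_avg :: "('a \<Rightarrow> 'a) \<Rightarrow> ('a \<Rightarrow> 'a) \<Rightarrow> ('a \<Rightarrow> real) \<Rightarrow> 'a \<Rightarrow> real" where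
  "walk_avg f g h x = (h (f x) + h (g x)) / 2"

text \<open>Preimages prepend a step, so membership at index \<open>n\<close> means that one of the
  \<open>2 ^ n\<close> words of length exactly \<open>n\<close> in \<open>f\<close> and
  \<open>g\<close> ends at \<open>c\<close>.\<close>

primrec hits :: "('a \<Rightarrow> 'a) \<Rightarrow> ('a \<Rightarrow> 'a) \<Rightarrow> 'a \<Rightarrow> nat \<Rightarrow> 'a set" where
  "hits f g c 0 = {c}"
| "hits f g c (Suc n) = f -` hits f g c n \<union> g -` hits f g c n"

lemma hits_mono:
  assumes "f c = c" "m \<le> n"
  shows "hits f g c m \<subseteq> hits f g c n"
proof -
  have "hits f g c n \<subseteq> hits f g c (Suc n)" for n
    by (induction n) (use assms(1) in auto)
  thus ?thesis using assms(2) lift_Suc_mono_le[of "hits f g c"] by blast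
qed

lemma walk_avg_funpow_bounds:
  assumes "f ` S \<subseteq> S" "g ` S \<subseteq> S" "\<forall>x\<in>S. l \<le> h x \<and> h x \<le> u" "x \<in> S"
  shows "l \<le> (walk_avg f g ^^ n) h x \<and> (walk_avg f g ^^ n) h x \<le> u"
  using assms(4)
proof (induction n arbitrary: x)
  case (Suc n)
  hence "f x \<in> S" "g x \<in> S" using assms(1,2) by auto
  from Suc.IH[OF this(1)] Suc.IH[OF this(2)] show ?case by (simp add: walk_avg_def)
qed (use assms(3) in auto)

text \<open>At least one of the \<open>2 ^ n\<close> equally likely words leads from
  \<open>x\<close> to \<open>c\<close>, so \<open>h c\<close> enters the average with weight at
  least \<open>1 / 2 ^ n\<close>; the remaining weight sits on values between \<open>l\<close> and
  \<open>u\<close>.\<close>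

lemma walk_avg_funpow_hits_bounds:
  assumes "f ` S \<subseteq> S" "g ` S \<subseteq> S" "\<forall>x\<in>S. l \<le> h x \<and> h x \<le> u"
    and "x \<in> S" "x \<in> hits f g c n"
  shows "l + (h c - l) / 2 ^ n \<le> (walk_avg f g ^^ n) h x \<and>
    (walk_avg f g ^^ n) h x \<le> u - (u - h c) / 2 ^ n"
  using assms(4,5)
proof (induction n arbitrary: x)
  case (Suc n)
  hence S: "f x \<in> S" "g x \<in> S" using assms(1,2) by auto
  note B = walk_avg_funpow_bounds[OF assms(1-3)]
  define d\<^sub>1 d\<^sub>2 where d: "d\<^sub>1 = (h c - l) / 2 ^ n" "d\<^sub>2 = (u - h c) / 2 ^ n"
  have e: "(walk_avg f g ^^ Suc n) h x = ((walk_avg f g ^^ n) h (f x) + (walk_avg f g ^^ n) h (g x)) / 2"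
    "(h c - l) / 2 ^ Suc n = d\<^sub>1 / 2" "(u - h c) / 2 ^ Suc n = d\<^sub>2 / 2"
    by (simp_all add: walk_avg_def d)
  from Suc.prems(2) consider "f x \<in> hits f g c n" | "g x \<in> hits f g c n" by auto
  thus ?case
  proof cases
    case 1
    from Suc.IH[OF S(1) this] B[OF S(2), where n = n] show ?thesis
      unfolding e d[symmetric] by auto
  next
    case 2
    from Suc.IH[OF S(2) this] B[OF S(1), where n = n] show ?thesis
      unfolding e d[symmetric] by auto
  qed
qed auto

text \<open>A permutation of \<open>S\<close> only reorders a sum over \<open>S\<close>; in other
  words, the uniform distribution is stationary.\<close>

lemma sum_walk_avg_funpow:
  assumes "bij_betw f S S" "bij_betw g S S"
  shows "sum ((walk_avg f g ^^ n) h) S = sum h S"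
proof (induction n)
  case (Suc n)
  have "sum ((walk_avg f g ^^ Suc n) h) S =
      ((\<Sum>x\<in>S. (walk_avg f g ^^ n) h (f x)) + (\<Sum>x\<in>S. (walk_avg f g ^^ n) h (g x))) / 2"
    by (simp add: walk_avg_def sum.distrib flip: sum_divide_distrib)
  thus ?case
    using Suc sum.reindex_bij_betw[OF assms(1), of "(walk_avg f g ^^ n) h"]
      sum.reindex_bij_betw[OF assms(2), of "(walk_avg f g ^^ n) h"] by (simp only: ) simp
qed simp

text \<open>The fixed point \<open>c\<close> makes the hitting sets increase, so some number \<open>m\<close> of steps leads from
  every state to \<open>c\<close> with probability at least \<open>2\<^sup>-\<^sup>m\<close>; hence \<open>m\<close> steps contract the oscillation
  of \<open>h\<close> by the factor \<open>1 - 2\<^sup>-\<^sup>m\<close>, while the mean is preserved.\<close>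

theorem walk_avg_tendsto_mean:
  assumes fin: "finite S" and f: "bij_betw f S S" and g: "bij_betw g S S" and c: "f c = c"
    and hit: "\<And>x. x \<in> S \<Longrightarrow> \<exists>n. x \<in> hits f g c n" and cS: "c \<in> S" and x: "x \<in> S"
  shows "(\<lambda>n. (walk_avg f g ^^ n) h x) \<longlonglongrightarrow> sum h S / card S"
proof -
  have S: "f ` S \<subseteq> S" "g ` S \<subseteq> S" using f g by (auto simp: bij_betw_def)
  obtain m where m: "\<And>x. x \<in> S \<Longrightarrow> x \<in> hits f g c m"
  proof -
    obtain k where k: "\<And>x. x \<in> S \<Longrightarrow> x \<in> hits f g c (k x)" using hit by metis
    have "x \<in> hits f g c (Max (k ` S))" if "x \<in> S" for x
      using k[OF that] hits_mono[where f = f, OF c, of "k x" "Max (k ` S)"] fin that by auto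
    thus thesis using that by blast
  qed
  define \<rho> :: real where "\<rho> = 1 - 1 / 2 ^ m"
  have \<rho>: "0 \<le> \<rho>" "\<rho> < 1" by (auto simp: \<rho>_def)
  define D where "D = Max (h ` S) - Min (h ` S)"
  have contract: "\<exists>l u. (\<forall>y\<in>S. l \<le> (walk_avg f g ^^ (j * m)) h y \<and>
      (walk_avg f g ^^ (j * m)) h y \<le> u) \<and> u - l = \<rho> ^ j * D" for j
  proof (induction j)
    case 0
    show ?case by (rule exI[of _ "Min (h ` S)"], rule exI[of _ "Max (h ` S)"]) (simp add: fin D_def)
  next
    case (Suc j)
    define h' where "h' = (walk_avg f g ^^ (j * m)) h"
    have e: "(walk_avg f g ^^ (Suc j * m)) h = (walk_avg f g ^^ m) h'"
      by (simp add: h'_def funpow_add)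
    obtain l u where lu: "\<forall>y\<in>S. l \<le> h' y \<and> h' y \<le> u" "u - l = \<rho> ^ j * D"
      using Suc h'_def by blast
    \<comment> \<open>Raising the lower bound and lowering the upper one gain
      \<open>(u - l) / 2 ^ m\<close> together, whatever the value \<open>h' c\<close> is.\<close>
    have "u - (u - h' c) / 2 ^ m - (l + (h' c - l) / 2 ^ m) = \<rho> * (u - l)"
      by (simp add: \<rho>_def field_simps)
    thus ?case
      unfolding e using walk_avg_funpow_hits_bounds[OF S lu(1) _ m] lu(2)
      by (rule_tac exI[of _ "l + (h' c - l) / 2 ^ m"], rule_tac exI[of _ "u - (u - h' c) / 2 ^ m"]) simp
  qed
  \<comment> \<open>Bounds valid at time \<open>j * m\<close> persist at all later times, and the
    preserved mean lies between them too, so the distance is at most their gap.\<close>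
  have bound: "\<bar>(walk_avg f g ^^ n) h x - sum h S / card S\<bar> \<le> \<rho> ^ j * D" if n: "n \<ge> j * m" for n j
  proof -
    obtain l u where lu: "\<forall>y\<in>S. l \<le> (walk_avg f g ^^ (j * m)) h y \<and>
        (walk_avg f g ^^ (j * m)) h y \<le> u" "u - l = \<rho> ^ j * D"
      using contract[of j] by blast
    have "(walk_avg f g ^^ n) h = (walk_avg f g ^^ (n - j * m)) ((walk_avg f g ^^ (j * m)) h)"
      using n by (metis comp_apply funpow_add le_add_diff_inverse2)
    hence b: "l \<le> (walk_avg f g ^^ n) h y \<and> (walk_avg f g ^^ n) h y \<le> u" if "y \<in> S" for y
      using walk_avg_funpow_bounds[OF S lu(1) that] by simp
    have pos: "real (card S) > 0" using x fin by (auto simp: card_gt_0_iff)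
    have "card S * l \<le> sum h S" "sum h S \<le> card S * u"
      using sum_bounded_below[of S l "(walk_avg f g ^^ n) h"]
        sum_bounded_above[of S "(walk_avg f g ^^ n) h" u] b
      by (simp_all add: sum_walk_avg_funpow[OF f g])
    hence "l \<le> sum h S / card S" "sum h S / card S \<le> u" using pos by (simp_all add: field_simps)
    thus ?thesis using b[OF x] lu(2) by linarith
  qed
  show ?thesis
  proof (rule LIMSEQ_I)
    fix e :: real assume e: "e > 0"
    have "(\<lambda>j. \<rho> ^ j * D) \<longlonglongrightarrow> 0"
      using \<rho> by (intro tendsto_mult_left_zero LIMSEQ_realpow_zero) auto
    from LIMSEQ_D[OF this e] obtain j where "norm (\<rho> ^ j * D - 0) < e" by blast
    thus "\<exists>N. \<forall>n\<ge>N. norm ((walk_avg f g ^^ n) h x - sum h S / card S) < e"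
      using bound[of j] by (intro exI[of _ "j * m"]) force
  qed
qed


section \<open>Primitive vectors modulo a prime power\<close>

text \<open>Coordinates are least residues. For \<open>N\<close> a positive power of
  \<open>p\<close> these are the pairs that generate the unit ideal modulo \<open>N\<close>;
  numerator and denominator of a reduced fraction always land here.\<close>

definition primitive_vectors :: "nat \<Rightarrow> nat \<Rightarrow> (nat \<times> nat) set" where
  "primitive_vectors p N = {(a, b). a < N \<and> b < N \<and> \<not> (p dvd a \<and> p dvd b)}"

definition left_child :: "nat \<Rightarrow> nat \<times> nat \<Rightarrow> nat \<times> nat" where
  "left_child N = (\<lambda>(a, b). (a, (a + b) mod N))"

definition right_child :: "nat \<Rightarrow> nat \<times> nat \<Rightarrow> nat \<times> nat" where
  "right_child N = (\<lambda>(a, b). ((a + b) mod N, b))"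

lemma finite_primitive_vectors [simp]: "finite (primitive_vectors p N)"
  by (rule finite_subset[of _ "{..<N} \<times> {..<N}"]) (auto simp: primitive_vectors_def)

lemma add_mod_cancel_left:
  fixes a b b' N :: nat
  assumes "(a + b) mod N = (a + b') mod N" "b < N" "b' < N"
  shows "b = b'"
  using assms cong_add_lcancel_nat[of a b b' N] cong_less_modulus_unique_nat[of b b' N]
  by (simp add: cong_def)

lemma add_mod_cancel_right:
  fixes a a' b N :: nat
  assumes "(a + b) mod N = (a' + b) mod N" "a < N" "a' < N"
  shows "a = a'"
  using assms add_mod_cancel_left[of b a N a'] by (simp add: add.commute)

text \<open>Since \<open>p dvd N\<close>, reduction modulo \<open>N\<close> respects divisibility by
  \<open>p\<close>, so the set is mapped into itself; on a finite set injectivity then gives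
  surjectivity.\<close>

lemma bij_left_child:
  assumes "p dvd N"
  shows "bij_betw (left_child N) (primitive_vectors p N) (primitive_vectors p N)"
proof (rule bij_betw_imageI)
  show inj: "inj_on (left_child N) (primitive_vectors p N)"
    by (auto simp: inj_on_def primitive_vectors_def left_child_def dest: add_mod_cancel_left)
  have "left_child N ` primitive_vectors p N \<subseteq> primitive_vectors p N"
    using assms by (auto simp: primitive_vectors_def left_child_def dvd_mod_iff dvd_add_right_iff)
  thus "left_child N ` primitive_vectors p N = primitive_vectors p N"
    using inj by (intro endo_inj_surj) auto
qed

lemma bij_right_child:
  assumes "p dvd N"
  shows "bij_betw (right_child N) (primitive_vectors p N) (primitive_vectors p N)"
proof (rule bij_betw_imageI)
  show inj: "inj_on (right_child N) (primitive_vectors p N)"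
    by (auto simp: inj_on_def primitive_vectors_def right_child_def
        dest: add_mod_cancel_right)
  have "right_child N ` primitive_vectors p N \<subseteq> primitive_vectors p N"
    using assms by (auto simp: primitive_vectors_def right_child_def dvd_mod_iff dvd_add_left_iff)
  thus "right_child N ` primitive_vectors p N = primitive_vectors p N"
    using inj by (intro endo_inj_surj) auto
qed

lemma left_child_funpow: "b < N \<Longrightarrow> (left_child N ^^ k) (a, b) = (a, (k * a + b) mod N)"
  by (induction k) (auto simp: left_child_def mod_simps algebra_simps)

lemma right_child_funpow: "a < N \<Longrightarrow> (right_child N ^^ k) (a, b) = ((a + k * b) mod N, b)"
  by (induction k) (auto simp: right_child_def mod_simps algebra_simps)

lemma hits_funpow:
  assumes "(f ^^ k) x \<in> hits f g c n \<or> (g ^^ k) x \<in> hits f g c n"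
  shows "x \<in> hits f g c (n + k)"
  using assms
proof (induction k arbitrary: n)
  case (Suc k)
  have "(f ^^ k) x \<in> hits f g c (Suc n) \<or> (g ^^ k) x \<in> hits f g c (Suc n)"
    using Suc.prems by auto
  from Suc.IH[OF this] show ?case by simp
qed simp

text \<open>If \<open>a\<close> is a unit, left steps add multiples of \<open>a\<close> to
  \<open>b\<close> until it becomes 1, and right steps then increase \<open>a\<close> by 1 until it
  wraps around to 0. If \<open>p\<close> divides \<open>a\<close>, then \<open>b\<close> is a unit
  and one right step makes the first coordinate a unit.\<close>

lemma primitive_vectors_hit:
  assumes p: "prime p" and k: "k > 0" and x: "x \<in> primitive_vectors p (p ^ k)"
  shows "\<exists>n. x \<in> hits (left_child (p ^ k)) (right_child (p ^ k)) (0, 1) n"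
proof -
  define N where "N = p ^ k"
  have N: "N > 1" "p dvd N"
    using k one_less_power[OF prime_gt_1_nat[OF p] k] by (auto simp: N_def)
  let ?H = "hits (left_child N) (right_child N) (0, 1)"
  have unit: "\<exists>n. (a, b) \<in> ?H n" if ab: "\<not> p dvd a" "a < N" "b < N" for a b
  proof -
    have "coprime a N"
      using prime_imp_coprime[OF p ab(1)] by (simp add: N_def coprime_commute)
    then obtain x where x: "[a * x = 1] (mod N)"
      using cong_solve_coprime_nat by force
    \<comment> \<open>Chosen so that \<open>j * a\<close> is congruent to \<open>1 - b\<close>; the
      extra \<open>N\<close> keeps the difference a natural number.\<close>
    define j where "j = x * (N + 1 - b)"
    have "[j * a + b = (N + 1 - b) * (a * x) + b] (mod N)" by (simp add: j_def algebra_simps)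
    also have "[(N + 1 - b) * (a * x) + b = (N + 1 - b) * 1 + b] (mod N)"
      using x by (intro cong_add cong_mult) auto
    also have "(N + 1 - b) * 1 + b = N + 1" using ab by simp
    finally have "(left_child N ^^ j) (a, b) = (a, 1)"
      using N ab mod_add_self1[of N 1] by (simp add: left_child_funpow cong_def)
    moreover have "(right_child N ^^ (N - a)) (a, 1) = (0, 1)"
      using ab by (simp add: right_child_funpow)
    hence "(a, 1) \<in> ?H (0 + (N - a))" by (intro hits_funpow) simp
    ultimately show ?thesis by (metis hits_funpow)
  qed
  obtain a b where ab: "x = (a, b)" "a < N" "b < N" "\<not> (p dvd a \<and> p dvd b)"
    using x by (auto simp: primitive_vectors_def N_def)
  show ?thesis
  proof (cases "p dvd a")
    case False
    thus ?thesis using unit[of a b] ab by (simp add: N_def)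
  next
    case True
    hence "\<not> p dvd (a + b) mod N" using ab N by (simp add: dvd_mod_iff dvd_add_right_iff)
    then obtain n where "((a + b) mod N, b) \<in> ?H n" using unit[of "(a + b) mod N" b] ab N by auto
    hence "(a, b) \<in> ?H (Suc n)" by (simp add: right_child_def)
    thus ?thesis unfolding ab(1) N_def by blast
  qed
qed

section \<open>Counting primitive vectors and those on a line\<close>

lemma card_multiples_lessThan:
  assumes "p > 0"
  shows "card {b. b < p * M \<and> p dvd b} = M"
proof -
  have "{b. b < p * M \<and> p dvd b} = (\<lambda>i. p * i) ` {..<M}" using assms by auto
  thus ?thesis using assms by (simp add: card_image inj_on_def)
qed

lemma card_nonmultiples_lessThan:
  assumes "p > 0"
  shows "card {b. b < p * M \<and> \<not> p dvd b} = p * M - M"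
proof -
  have "{b. b < p * M \<and> \<not> p dvd b} = {..<p * M} - {b. b < p * M \<and> p dvd b}" by auto
  moreover have "{b. b < p * M \<and> p dvd b} \<subseteq> {..<p * M}" by auto
  ultimately show ?thesis
    using card_multiples_lessThan[OF assms, of M] by (simp add: card_Diff_subset)
qed

lemma card_primitive_vectors:
  assumes "p > 0"
  shows "card (primitive_vectors p (p * M)) = (p * M)\<^sup>2 - M\<^sup>2"
proof -
  define D where "D = {b. b < p * M \<and> p dvd b}"
  have D: "finite D" "card D = M" "D \<times> D \<subseteq> {..<p * M} \<times> {..<p * M}"
    using card_multiples_lessThan[OF assms, of M] by (auto simp: D_def)
  have "primitive_vectors p (p * M) = ({..<p * M} \<times> {..<p * M}) - D \<times> D"
    by (auto simp: primitive_vectors_def D_def)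
  thus ?thesis using D by (simp add: card_Diff_subset power2_eq_square)
qed

text \<open>On the line \<open>a\<close> is determined by \<open>b\<close>, and
  \<open>p dvd b\<close> would force \<open>p dvd a\<close>. Hence the points correspond to the
  residues \<open>b\<close> prime to \<open>p\<close>.\<close>

lemma card_primitive_vectors_line:
  assumes "p > 0" "M > 0"
  shows "card {(a, b) \<in> primitive_vectors p (p * M). [a = c * b] (mod p * M)} = p * M - M"
proof -
  have "{(a, b) \<in> primitive_vectors p (p * M). [a = c * b] (mod p * M)} =
      (\<lambda>b. ((c * b) mod (p * M), b)) ` {b. b < p * M \<and> \<not> p dvd b}"
  proof (intro equalityI subsetI)
    fix x assume "x \<in> {(a, b) \<in> primitive_vectors p (p * M). [a = c * b] (mod p * M)}"
    then obtain a b where x: "x = (a, b)" "a < p * M" "b < p * M" "\<not> (p dvd a \<and> p dvd b)"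
      "[a = c * b] (mod p * M)"
      by (auto simp: primitive_vectors_def)
    have "a = (c * b) mod (p * M)" using x by (simp add: cong_def)
    moreover from this have "\<not> p dvd b" using x(4) by (auto simp: dvd_mod_iff)
    ultimately show "x \<in> (\<lambda>b. ((c * b) mod (p * M), b)) ` {b. b < p * M \<and> \<not> p dvd b}"
      using x by auto
  qed (use assms in \<open>auto simp: primitive_vectors_def cong_def\<close>)
  thus ?thesis using card_nonmultiples_lessThan[OF assms(1), of M]
    by (simp add: card_image inj_on_def)
qed


section \<open>The Calkin--Wilf tree as a random walk\<close>

lemma cw_fractions_pos_coprime:
  "(a, b) \<in> cw_fractions n \<Longrightarrow> a > 0 \<and> b > 0 \<and> coprime a b"
proof (induction n arbitrary: a b rule: cw_fractions.induct)
  case (3 n)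
  then obtain c d where "(c, d) \<in> cw_fractions (Suc n)" "(a, b) = (c, c + d) \<or> (a, b) = (c + d, d)"
    by auto
  with "3.IH"[of c d] show ?case by (auto simp: coprime_iff_gcd_eq_1)
qed auto

lemma finite_cw_fractions [simp]: "finite (cw_fractions n)"
  by (induction n rule: cw_fractions.induct) auto

lemma swap_cw_fractions: "(a, b) \<in> cw_fractions n \<Longrightarrow> (b, a) \<in> cw_fractions n"
proof (induction n arbitrary: a b rule: cw_fractions.induct)
  case (3 n)
  then obtain c d where "(c, d) \<in> cw_fractions (Suc n)" "(a, b) = (c, c + d) \<or> (a, b) = (c + d, d)"
    by auto
  with "3.IH"[of c d] show ?case by (auto simp: add.commute intro!: bexI[of _ "(d, c)"])
qed auto

text \<open>Left children are below 1 and right children above 1, and subtraction recovers the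
  parent, so no fraction is counted twice.\<close>

lemma sum_cw_fractions_Suc:
  fixes h :: "nat \<times> nat \<Rightarrow> real"
  shows "sum h (cw_fractions (Suc (Suc n))) =
    (\<Sum>(a, b)\<in>cw_fractions (Suc n). h (a, a + b) + h (a + b, b))"
proof -
  have "sum h (cw_fractions (Suc (Suc n))) =
      (\<Sum>x\<in>cw_fractions (Suc n). sum h (case x of (a, b) \<Rightarrow> {(a, a + b), (a + b, b)}))"
    unfolding cw_fractions.simps
  proof (rule sum.UNION_disjoint)
    show "\<forall>x\<in>cw_fractions (Suc n). \<forall>y\<in>cw_fractions (Suc n). x \<noteq> y \<longrightarrow>
      (case x of (a, b) \<Rightarrow> {(a, a + b), (a + b, b)}) \<inter> (case y of (a, b) \<Rightarrow> {(a, a + b), (a + b, b)}) = {}"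
      by (auto dest!: cw_fractions_pos_coprime)
  qed auto
  also have "\<dots> = (\<Sum>(a, b)\<in>cw_fractions (Suc n). h (a, a + b) + h (a + b, b))"
    by (intro sum.cong) (auto dest!: cw_fractions_pos_coprime)
  finally show ?thesis .
qed

text \<open>The induction is over all \<open>h\<close>, because the last generation is absorbed into
  \<open>h\<close> by one application of \<open>walk_avg\<close>; \<open>funpow_swap1\<close> then
  moves this innermost average to the outside.\<close>

lemma sum_cw_fractions_mod:
  "(\<Sum>(a, b)\<in>cw_fractions (Suc n). h (a mod N, b mod N)) =
    2 ^ n * (walk_avg (left_child N) (right_child N) ^^ n) h (1 mod N, 1 mod N)"
proof (induction n arbitrary: h)
  case (Suc n)
  have "(\<Sum>(a, b)\<in>cw_fractions (Suc (Suc n)). h (a mod N, b mod N)) =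
      (\<Sum>(a, b)\<in>cw_fractions (Suc n). 2 * walk_avg (left_child N) (right_child N) h (a mod N, b mod N))"
    by (subst sum_cw_fractions_Suc)
      (auto simp: walk_avg_def left_child_def right_child_def mod_simps intro!: sum.cong)
  also have "\<dots> = 2 * (2 ^ n * (walk_avg (left_child N) (right_child N) ^^ n)
      (walk_avg (left_child N) (right_child N) h) (1 mod N, 1 mod N))"
    by (subst Suc[symmetric]) (simp add: sum_distrib_left case_prod_unfold)
  finally show ?case by (simp add: funpow_swap1)
qed simp

lemma inj_on_cw_fractions: "inj_on (\<lambda>(a, b). of_nat a / of_nat b :: rat) (cw_fractions n)"
proof (rule inj_onI, clarify)
  fix a b c d
  assume ab: "(a, b) \<in> cw_fractions n" and cd: "(c, d) \<in> cw_fractions n"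
    and eq: "(of_nat a / of_nat b :: rat) = of_nat c / of_nat d"
  note pos = cw_fractions_pos_coprime[OF ab] cw_fractions_pos_coprime[OF cd]
  have "(of_nat (a * d) :: rat) = of_nat (c * b)" using eq pos by (simp add: field_simps)
  hence "a * d = c * b" by (rule of_nat_eq_iff[THEN iffD1])
  thus "a = c \<and> b = d" using pos coprime_crossproduct_nat[of a b c d]
    by (simp add: mult.commute coprime_commute)
qed

text \<open>The index is shifted: generation \<open>Suc n\<close> has \<open>2 ^ n\<close> members,
  which avoids integer exponents.\<close>

definition cw_freq :: "(rat \<Rightarrow> bool) \<Rightarrow> nat \<Rightarrow> real" where
  "cw_freq P n = real (card {q \<in> cw_generation (Suc n). P q}) / 2 ^ n"

lemma cw_freq_eq:
  "cw_freq P n = (\<Sum>(a, b)\<in>cw_fractions (Suc n). of_bool (P (of_nat a / of_nat b))) / 2 ^ n"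
proof -
  have "{q \<in> cw_generation (Suc n). P q} =
      (\<lambda>(a, b). of_nat a / of_nat b) ` {x \<in> cw_fractions (Suc n). P (case x of (a, b) \<Rightarrow> of_nat a / of_nat b)}"
    by (auto simp: cw_generation_def)
  hence "card {q \<in> cw_generation (Suc n). P q} =
      card {x \<in> cw_fractions (Suc n). P (case x of (a, b) \<Rightarrow> of_nat a / of_nat b)}"
    using inj_on_subset[OF inj_on_cw_fractions, of _ "Suc n"]
    by (simp del: cw_fractions.simps add: card_image)
  thus ?thesis
    by (simp del: cw_fractions.simps add: cw_freq_def case_prod_unfold Int_def)
qed

text \<open>Only positive rationals occur in the tree, so equivalences about valuations of inverses
  that fail at 0 may be used.\<close>

lemma cw_freq_cong:
  assumes "\<And>q. q > 0 \<Longrightarrow> P q \<longleftrightarrow> Q q"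
  shows "cw_freq P = cw_freq Q"
  unfolding cw_freq_eq fun_eq_iff
  by (intro allI arg_cong2[where f = "(/)"] sum.cong refl)
    (auto simp: assms simp del: cw_fractions.simps dest!: cw_fractions_pos_coprime)

lemma cw_freq_inverse: "cw_freq (\<lambda>q. P (inverse q)) = cw_freq P"
proof
  fix n
  have "bij_betw prod.swap (cw_fractions (Suc n)) (cw_fractions (Suc n))"
    by (rule bij_betwI[where g = prod.swap])
      (auto simp: swap_cw_fractions simp del: cw_fractions.simps)
  from sum.reindex_bij_betw[OF this, of "\<lambda>(a, b). of_bool (P (of_nat a / of_nat b))"]
  show "cw_freq (\<lambda>q. P (inverse q)) n = cw_freq P n"
    by (simp del: cw_fractions.simps sum_of_bool_eq add: cw_freq_eq case_prod_unfold)
qed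

lemma sum_cw_fractions_const: "(\<Sum>x\<in>cw_fractions (Suc n). 1) = (2 ^ n :: real)"
proof (induction n)
  case (Suc n)
  show ?case unfolding sum_cw_fractions_Suc case_prod_unfold by (simp only: sum.distrib Suc) simp
qed simp

lemma cw_freq_not: "cw_freq (\<lambda>q. \<not> P q) n = 1 - cw_freq P n"
  unfolding cw_freq_eq
  by (simp del: cw_fractions.simps sum_constant
      add: of_bool_not_iff case_prod_unfold sum_subtractf sum_cw_fractions_const diff_divide_distrib)

text \<open>The limit is the proportion of primitive vectors on the line. With
  \<open>N = p ^ k\<close> and \<open>M = p ^ (k - 1)\<close> it is
  \<open>(N - M) / (N^2 - M^2) = 1 / (N + M)\<close>.\<close>

lemma cw_freq_line_tendsto:
  assumes p: "prime p" and k: "k > 0"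
    and P: "\<And>a b. b > 0 \<Longrightarrow> coprime a b \<Longrightarrow> P (of_nat a / of_nat b) \<longleftrightarrow> [a = c * b] (mod p ^ k)"
  shows "cw_freq P \<longlonglongrightarrow> 1 / (real p ^ k + real p ^ (k - 1))"
proof -
  define M where "M = p ^ (k - 1)"
  have N: "p ^ k = p * M" using k by (simp add: M_def flip: power_Suc)
  have p0: "p > 1" "M > 0" using prime_gt_1_nat[OF p] by (auto simp: M_def)
  let ?S = "primitive_vectors p (p ^ k)"
  define h :: "nat \<times> nat \<Rightarrow> real" where "h = (\<lambda>(a, b). of_bool ([a = c * b] (mod p ^ k)))"
  have one: "1 mod p ^ k = (1::nat)" "1 < p ^ k" using one_less_power[OF p0(1) k] p0 k by simp_all
  have freq: "cw_freq P n = (walk_avg (left_child (p ^ k)) (right_child (p ^ k)) ^^ n) h (1, 1)" for n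
  proof -
    have "(\<Sum>(a, b)\<in>cw_fractions (Suc n). of_bool (P (of_nat a / of_nat b)) :: real) =
        (\<Sum>(a, b)\<in>cw_fractions (Suc n). h (a mod p ^ k, b mod p ^ k))"
      by (intro sum.cong)
        (auto simp: h_def P cong_def mod_simps simp del: cw_fractions.simps
          dest!: cw_fractions_pos_coprime)
    thus ?thesis by (simp only: cw_freq_eq sum_cw_fractions_mod one) simp
  qed
  have "sum h ?S = card {(a, b) \<in> ?S. [a = c * b] (mod p ^ k)}"
    by (simp add: h_def case_prod_unfold Int_def)
  also have "\<dots> = real p * M - M"
    using card_primitive_vectors_line[of p M c] p0 by (simp add: N of_nat_diff)
  finally have sum: "sum h ?S = real p * M - M" .
  have "M\<^sup>2 \<le> (p * M)\<^sup>2" using p0 by (intro power_mono) auto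
  hence card: "real (card ?S) = (real p * M)\<^sup>2 - (real M)\<^sup>2"
    using p0 by (simp add: N card_primitive_vectors of_nat_diff)
  have pos: "real p * M - M > 0" using p0 by (simp add: mult_less_cancel_right1)
  have "(real p * M)\<^sup>2 - (real M)\<^sup>2 = (real p * M - M) * (real p * M + M)"
    by (simp add: power2_eq_square algebra_simps)
  moreover have "real p ^ k = real p * M" "real p ^ (k - 1) = M"
    using N by (simp_all add: M_def flip: of_nat_power of_nat_mult)
  ultimately have "sum h ?S / card ?S = 1 / (real p ^ k + real p ^ (k - 1))"
    unfolding sum card using nonzero_divide_mult_cancel_left[OF pos[THEN less_imp_neq, THEN not_sym]]
    by (simp only:)
  moreover have "(\<lambda>n. (walk_avg (left_child (p ^ k)) (right_child (p ^ k)) ^^ n) h (1, 1))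
      \<longlonglongrightarrow> sum h ?S / card ?S"
    using one p k prime_gt_1_nat[OF p]
    by (intro walk_avg_tendsto_mean[where c = "(0, 1)"] bij_left_child bij_right_child
        primitive_vectors_hit finite_primitive_vectors)
      (auto simp: left_child_def primitive_vectors_def)
  moreover have "cw_freq P = (\<lambda>n. (walk_avg (left_child (p ^ k)) (right_child (p ^ k)) ^^ n) h (1, 1))"
    using freq by blast
  ultimately show ?thesis by simp
qed


section \<open>Valuations\<close>

lemma le_rat_ord_divide_iff:
  assumes p: "prime p" and b: "\<not> int p dvd b"
  shows "Fin (int k) \<le> rat_ord p (of_int a / of_int b) \<longleftrightarrow> int p ^ k dvd a"
proof (cases "a = 0")
  case False
  have "b \<noteq> 0" using b by auto
  moreover have "multiplicity (int p) b = 0" using b by (simp add: not_dvd_imp_multiplicity_0)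
  moreover have "int p ^ k dvd a \<longleftrightarrow> k \<le> multiplicity (int p) a"
    using False p prime_gt_1_nat[OF p] by (intro power_dvd_iff_le_multiplicity) auto
  ultimately show ?thesis using rat_ord_divide[OF p False] by simp
qed simp

lemma le_rat_ord_diff_cong:
  assumes p: "prime p" and "Fin \<nu> \<le> rat_ord p (r - r')"
  shows "Fin \<nu> \<le> rat_ord p (q - r) \<longleftrightarrow> Fin \<nu> \<le> rat_ord p (q - r')"
  using rat_ord_add_ge[OF p _ assms(2), of "q - r"] rat_ord_diff_ge[OF p _ assms(2), of "q - r'"]
  by auto

lemma rat_ord_inverse:
  assumes p: "prime p" and "rat_ord p q = Fin v"
  shows "rat_ord p (inverse q) = Fin (- v)"
proof -
  have "q \<noteq> 0" using assms by auto
  hence "rat_ord p q + rat_ord p (inverse q) = Fin 0"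
    using rat_ord_mult[OF p, of q "inverse q"] p by simp
  thus ?thesis using assms(2) by (cases "rat_ord p (inverse q)") auto
qed

text \<open>The reduced denominator of \<open>r\<close> is prime to \<open>p\<close>, hence
  invertible modulo \<open>p ^ k\<close>; \<open>c\<close> is the residue of the numerator times
  that inverse.\<close>

lemma rat_integral_approx:
  assumes p: "prime p" and r: "Fin 0 \<le> rat_ord p r"
  obtains c :: nat where "Fin (int k) \<le> rat_ord p (of_nat c - r)"
proof -
  obtain a b where q: "quotient_of r = (a, b)" by force
  have b: "b > 0" "coprime a b" "r = of_int a / of_int b"
    using quotient_of_denom_pos[OF q] quotient_of_coprime[OF q] quotient_of_div[OF q] by auto
  have pb: "\<not> int p dvd b"
  proof
    assume pb: "int p dvd b"
    hence pa: "\<not> int p dvd a" using b(2) p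
      by (metis coprime_common_divisor not_prime_unit prime_nat_int_transfer)
    hence a: "a \<noteq> 0" by auto
    have "multiplicity (int p) b > 0"
      using pb b p by (intro multiplicity_gt_zero_iff[THEN iffD2]) auto
    thus False using r pa a b(1) unfolding b(3)
      by (simp add: rat_ord_divide[OF p] not_dvd_imp_multiplicity_0)
  qed
  have "coprime b (int p ^ k)"
    using pb p by (metis coprime_commute coprime_power_left_iff prime_imp_coprime prime_nat_int_transfer)
  then obtain x where x: "[b * x = 1] (mod int p ^ k)" using cong_solve_coprime_int by blast
  define c where "c = nat ((a * x) mod int p ^ k)"
  have c: "[int c = a * x] (mod int p ^ k)"
    using prime_gt_0_nat[OF p] by (simp add: c_def)
  have "[int c * b = a * x * b] (mod int p ^ k)" using c by (intro cong_mult) auto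
  also have "a * x * b = a * (b * x)" by simp
  also have "[a * (b * x) = a * 1] (mod int p ^ k)" using x by (intro cong_mult) auto
  finally have "int p ^ k dvd int c * b - a" by (simp add: cong_iff_dvd_diff)
  moreover have "of_nat c - r = of_int (int c * b - a) / of_int b" using b by (simp add: field_simps)
  ultimately show thesis using that le_rat_ord_divide_iff[OF p pb] by metis
qed

text \<open>When \<open>p\<close> divides \<open>b\<close>, both sides fail: \<open>a\<close> is
  then prime to \<open>p\<close>, so \<open>a - c * b\<close> is not divisible by \<open>p\<close>
  and the difference has valuation at most 0, which is less than \<open>k\<close>.\<close>

lemma le_rat_ord_diff_nat_iff:
  assumes p: "prime p" and k: "k > 0" and b: "b > 0" and ab: "coprime a b"
  shows "Fin (int k) \<le> rat_ord p (of_nat a / of_nat b - of_nat c) \<longleftrightarrow> [a = c * b] (mod p ^ k)"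
proof -
  have e: "(of_nat a / of_nat b - of_nat c :: rat) = of_int (int a - int c * int b) / of_int (int b)"
    using b by (simp add: field_simps)
  have cong: "[a = c * b] (mod p ^ k) \<longleftrightarrow> int p ^ k dvd int a - int c * int b"
    by (simp add: cong_iff_dvd_diff flip: cong_int_iff)
  show ?thesis
  proof (cases "p dvd b")
    case False
    hence "\<not> int p dvd int b" by simp
    from le_rat_ord_divide_iff[OF p this] show ?thesis unfolding e cong .
  next
    case True
    hence pa: "\<not> p dvd a" using ab p by (metis coprime_common_divisor_nat not_prime_1 )
    have pn: "\<not> int p dvd int a - int c * int b"
      using pa True by (simp add: dvd_diff_left_iff)
    hence 1: "\<not> int p ^ k dvd int a - int c * int b"
      using k by (meson dvd_power dvd_trans)
    have nz: "int a - int c * int b \<noteq> 0" using pn by auto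
    have "\<not> Fin (int k) \<le> rat_ord p (of_nat a / of_nat b - of_nat c)"
      using rat_ord_divide[OF p nz, of "int b"] b pn k
      unfolding e by (simp add: not_dvd_imp_multiplicity_0 del: of_int_diff of_int_mult of_int_of_nat_eq)
    thus ?thesis using 1 cong by simp
  qed
qed

text \<open>Being closer to \<open>r\<close> than its own size forces \<open>q\<close> to have
  valuation \<open>v\<close> as well; dividing \<open>r - q\<close> by \<open>q * r\<close> then
  shifts the valuation by \<open>- 2 * v\<close>.\<close>

lemma le_rat_ord_diff_inverse:
  assumes p: "prime p" and r: "rat_ord p r = Fin v" and v: "v < \<nu>" and q: "Fin \<nu> \<le> rat_ord p (q - r)"
  shows "Fin (\<nu> - 2 * v) \<le> rat_ord p (inverse q - inverse r)"
proof -
  have rq: "Fin \<nu> \<le> rat_ord p (r - q)" using q rat_ord_uminus[OF p, of "q - r"] by simp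
  hence "Fin (v + 1) \<le> rat_ord p (r - q)" using v by (cases "rat_ord p (r - q)") auto
  hence qv: "rat_ord p q = Fin v" by (rule rat_ord_eqI[OF p r])
  have nz: "q \<noteq> 0" "r \<noteq> 0" using qv r by auto
  have "inverse q - inverse r = (r - q) * (inverse q * inverse r)" using nz by (simp add: field_simps)
  moreover have "rat_ord p (inverse q * inverse r) = Fin (- v - v)"
    using rat_ord_mult[OF p] rat_ord_inverse[OF p] qv r by simp
  ultimately show ?thesis
    using rat_ord_mult_ge[OF p rq, of "- v - v" "inverse q * inverse r"] by simp
qed

text \<open>The converse is the same implication for the inverses, with \<open>- v\<close> and
  \<open>\<nu> - 2 * v\<close> in place of \<open>v\<close> and \<open>\<nu>\<close>.\<close>

lemma le_rat_ord_diff_inverse_iff: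
  assumes p: "prime p" and r: "rat_ord p r = Fin v" and v: "v < \<nu>"
  shows "Fin \<nu> \<le> rat_ord p (q - r) \<longleftrightarrow> Fin (\<nu> - 2 * v) \<le> rat_ord p (inverse q - inverse r)"
  using le_rat_ord_diff_inverse[OF p r v, of q]
    le_rat_ord_diff_inverse[OF p rat_ord_inverse[OF p r], of "\<nu> - 2 * v" "inverse q"] v
  by auto

section \<open>From p-adic numbers to rational approximations\<close>

lemma padic_cauchy_const_diff:
  assumes p: "prime p" and s: "padic_cauchy p s"
  shows "padic_cauchy p (\<lambda>n. q - s n)"
  using padic_cauchy_add[OF p padic_cauchy_const[of p q]
      padic_cauchy_mult[OF p padic_cauchy_const[of p "- 1"] s]] by simp

lemma Qp_minus_coset:
  assumes p: "prime p" and s: "padic_cauchy p s"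
  shows "padic_of_rat p q \<ominus>\<^bsub>Qp p\<^esub> (padic_null p +>\<^bsub>cauchy_ring p\<^esub> s) =
    padic_null p +>\<^bsub>cauchy_ring p\<^esub> (\<lambda>n. q - s n)"
proof -
  interpret I: ideal "padic_null p" "cauchy_ring p" using padic_null_ideal[OF p] .
  interpret Q: field "Qp p" using Qp_field[OF p] .
  define w where "w = padic_null p +>\<^bsub>cauchy_ring p\<^esub> s"
  define d where "d = padic_null p +>\<^bsub>cauchy_ring p\<^esub> (\<lambda>n. q - s n)"
  have qs: "padic_cauchy p (\<lambda>n. q - s n)"
    by (rule padic_cauchy_const_diff[OF p s])
  have car: "w \<in> carrier (Qp p)" "d \<in> carrier (Qp p)"
    using s qs by (auto simp: w_def d_def Qp_carrier)
  have "d \<oplus>\<^bsub>Qp p\<^esub> w = padic_of_rat p q"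
    using I.a_rcos_sum[of "\<lambda>n. q - s n" s] qs s
    by (simp add: d_def w_def padic_of_rat_def Qp_def FactRing_def cauchy_ring_def)
  hence "padic_of_rat p q \<ominus>\<^bsub>Qp p\<^esub> w = d"
    using car by (metis Q.add.inv_solve_right' Q.add.m_closed Q.minus_eq)
  thus ?thesis by (simp add: w_def d_def)
qed

text \<open>A late enough term of a Cauchy sequence for \<open>z\<close> has the valuation of
  \<open>z\<close> and agrees with all later terms up to order \<open>\<nu>\<close>. This reduces
  the problem to rational centres; \<open>r\<close> depends on \<open>\<nu>\<close>.\<close>

lemma padic_rat_approx:
  assumes p: "prime p" and z: "z \<in> carrier (Qp p)"
  obtains r where "rat_ord p r = padic_ord p z"
    "\<And>q. Fin \<nu> \<le> padic_ord p (padic_of_rat p q \<ominus>\<^bsub>Qp p\<^esub> z) \<longleftrightarrow> Fin \<nu> \<le> rat_ord p (q - r)"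
proof (cases "z = \<zero>\<^bsub>Qp p\<^esub>")
  case True
  interpret Q: field "Qp p" using Qp_field[OF p] .
  have "padic_of_rat p q \<in> carrier (Qp p)" for q
    by (auto simp: Qp_carrier padic_of_rat_def intro!: padic_cauchy_const)
  thus thesis using that[of 0] True by (simp add: padic_ord_of_rat[OF p] Q.minus_eq)
next
  case False
  obtain s where s: "padic_cauchy p s" and z: "z = padic_null p +>\<^bsub>cauchy_ring p\<^esub> s"
    using z by (auto simp: Qp_carrier)
  have "s \<notin> padic_null p" using False Qp_coset_eq_zero_iff[OF p s] z by simp
  from padic_ord_coset(1)[OF p s this] obtain M where
    M: "\<And>n. n \<ge> M \<Longrightarrow> rat_ord p (s n) = padic_ord p z"
    by (auto simp: eventually_sequentially z)
  obtain N where N: "\<And>m n. m \<ge> N \<Longrightarrow> n \<ge> N \<Longrightarrow> Fin \<nu> \<le> rat_ord p (s m - s n)"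
    using s unfolding padic_cauchy_def by meson
  define r where "r = s (max M N)"
  have qr: "Fin \<nu> \<le> rat_ord p (q - r) \<longleftrightarrow> Fin \<nu> \<le> rat_ord p (q - s n)" if "n \<ge> N" for q n
    using N that by (intro le_rat_ord_diff_cong[OF p]) (simp add: r_def)
  have "Fin \<nu> \<le> padic_ord p (padic_of_rat p q \<ominus>\<^bsub>Qp p\<^esub> z) \<longleftrightarrow> Fin \<nu> \<le> rat_ord p (q - r)" for q
  proof -
    define t where "t = (\<lambda>n. q - s n)"
    have t: "padic_cauchy p t"
      unfolding t_def by (rule padic_cauchy_const_diff[OF p s])
    have e: "padic_of_rat p q \<ominus>\<^bsub>Qp p\<^esub> z = padic_null p +>\<^bsub>cauchy_ring p\<^esub> t"
      unfolding z t_def by (rule Qp_minus_coset[OF p s])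
    \<comment> \<open>If \<open>t\<close> is a null sequence, then \<open>q\<close> equals
      \<open>z\<close> and the left side holds with valuation \<open>Pinf\<close>; otherwise the
      valuation is that of a late term of \<open>t\<close>.\<close>
    show ?thesis
    proof (cases "t \<in> padic_null p")
      case True
      then obtain K where "\<forall>n\<ge>K. Fin \<nu> \<le> rat_ord p (t n)" by (auto simp: padic_null_def)
      hence "Fin \<nu> \<le> rat_ord p (q - r)" using qr[of "max K N" q] by (simp add: t_def)
      thus ?thesis using True Qp_coset_eq_zero_iff[OF p t] by (simp add: e)
    next
      case False
      from padic_ord_coset(1)[OF p t this] obtain K where
        "\<forall>n\<ge>K. rat_ord p (t n) = padic_ord p (padic_null p +>\<^bsub>cauchy_ring p\<^esub> t)"
        by (auto simp: eventually_sequentially)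
      thus ?thesis using qr[of "max K N" q] by (simp add: e t_def)
    qed
  qed
  thus thesis using that[of r] M[of "max M N"] by (simp add: r_def)
qed


section \<open>The limit frequencies\<close>

lemma cw_freq_integral_tendsto:
  assumes p: "prime p" and r: "Fin 0 \<le> rat_ord p r" and \<nu>: "\<nu> \<ge> 1"
  shows "cw_freq (\<lambda>q. Fin \<nu> \<le> rat_ord p (q - r)) \<longlonglongrightarrow>
    1 / (real p powi \<nu> + real p powi (\<nu> - 1))"
proof -
  define k where "k = nat \<nu>"
  have k: "k > 0" "\<nu> = int k" "\<nu> - 1 = int (k - 1)" using \<nu> by (auto simp: k_def)
  obtain c where c: "Fin (int k) \<le> rat_ord p (of_nat c - r)"
    using rat_integral_approx[OF p r] by blast
  have "(\<lambda>q. Fin \<nu> \<le> rat_ord p (q - r)) = (\<lambda>q. Fin (int k) \<le> rat_ord p (q - of_nat c))"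
    using le_rat_ord_diff_cong[OF p c] k(2) by auto
  moreover have "cw_freq (\<lambda>q. Fin (int k) \<le> rat_ord p (q - of_nat c)) \<longlonglongrightarrow>
      1 / (real p ^ k + real p ^ (k - 1))"
    using le_rat_ord_diff_nat_iff[OF p k(1)] by (intro cw_freq_line_tendsto[OF p k(1)])
  ultimately show ?thesis unfolding k(3) by (simp add: k(2))
qed

text \<open>Inversion moves the centre to \<open>inverse r\<close>, which is
  \<open>p\<close>-integral, and the new threshold \<open>\<nu> + 2 * l\<close> is at least
  1.\<close>

lemma cw_freq_nonintegral_tendsto:
  assumes p: "prime p" and r: "rat_ord p r = Fin (- l)" and l: "l > 0" "- l < \<nu>"
  shows "cw_freq (\<lambda>q. Fin \<nu> \<le> rat_ord p (q - r)) \<longlonglongrightarrow>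
    1 / (real p powi (\<nu> + 2 * l) + real p powi (\<nu> + 2 * l - 1))"
proof -
  have "(\<lambda>q. Fin \<nu> \<le> rat_ord p (q - r)) =
      (\<lambda>q. Fin (\<nu> + 2 * l) \<le> rat_ord p (inverse q - inverse r))"
    using le_rat_ord_diff_inverse_iff[OF p r l(2)] by auto
  hence "cw_freq (\<lambda>q. Fin \<nu> \<le> rat_ord p (q - r)) =
      cw_freq (\<lambda>q. Fin (\<nu> + 2 * l) \<le> rat_ord p (q - inverse r))"
    using cw_freq_inverse[of "\<lambda>q. Fin (\<nu> + 2 * l) \<le> rat_ord p (q - inverse r)"] by simp
  moreover have "Fin 0 \<le> rat_ord p (inverse r)" using rat_ord_inverse[OF p r] l by simp
  ultimately show ?thesis using cw_freq_integral_tendsto[OF p, of "inverse r" "\<nu> + 2 * l"] l by simp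
qed

text \<open>At this threshold \<open>r\<close> cannot be told apart from 0. Allowing such
  \<open>r\<close> instead of 0 alone also settles convergence for the nonzero \<open>z\<close> to
  which no formula of the theorem applies.\<close>

lemma cw_freq_nonpos_tendsto:
  assumes p: "prime p" and r: "Fin (- \<nu>) \<le> rat_ord p r" and \<nu>: "\<nu> \<ge> 0"
  shows "cw_freq (\<lambda>q. Fin (- \<nu>) \<le> rat_ord p (q - r)) \<longlonglongrightarrow>
    1 - 1 / (real p powi (\<nu> + 1) + real p powi \<nu>)"
proof -
  let ?P = "\<lambda>q. Fin (\<nu> + 1) \<le> rat_ord p (q - 0)"
  have "Fin (- \<nu>) \<le> rat_ord p (q - r) \<longleftrightarrow> \<not> ?P (inverse q)" if q: "q > 0" for q
  proof -
    obtain v where v: "rat_ord p q = Fin v" using q by (cases "rat_ord p q") auto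
    show ?thesis using le_rat_ord_diff_cong[OF p, of "- \<nu>" r 0 q] r v rat_ord_inverse[OF p v] by auto
  qed
  hence "cw_freq (\<lambda>q. Fin (- \<nu>) \<le> rat_ord p (q - r)) = cw_freq (\<lambda>q. \<not> ?P (inverse q))"
    by (rule cw_freq_cong)
  also have "\<dots> = (\<lambda>n. 1 - cw_freq ?P n)"
    using cw_freq_inverse[of "\<lambda>q. \<not> ?P q"] cw_freq_not[of ?P] by (simp add: fun_eq_iff)
  moreover have "(\<lambda>n. 1 - cw_freq ?P n) \<longlonglongrightarrow> 1 - 1 / (real p powi (\<nu> + 1) + real p powi (\<nu> + 1 - 1))"
    using \<nu> by (intro tendsto_diff tendsto_const cw_freq_integral_tendsto[OF p]) auto
  ultimately show ?thesis by simp
qed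

lemma cw_F_Suc: "cw_F p (Suc n) z \<nu> = cw_freq (\<lambda>q. Fin \<nu> \<le> padic_ord p (padic_of_rat p q \<ominus>\<^bsub>Qp p\<^esub> z)) n"
  by (simp add: cw_F_def cw_freq_def power_int_minus field_simps)

theorem theorem4:
  fixes p :: nat and z :: "(nat \<Rightarrow> rat) set" and \<nu> :: int
  assumes "prime p" and "z \<in> carrier (Qp p)"
  shows "convergent (\<lambda>n. cw_F p n z \<nu>) \<and>
    (z \<in> padic_integers p \<and>
       (z \<noteq> \<zero>\<^bsub>Qp p\<^esub> \<and> padic_ord p z < Fin \<nu> \<or> z = \<zero>\<^bsub>Qp p\<^esub> \<and> \<nu> \<ge> 1) \<longrightarrow>
       cw_mu p z \<nu> = 1 / (real p powi \<nu> + real p powi (\<nu> - 1))) \<and>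
    (\<forall>l::int. z \<notin> padic_integers p \<and> padic_ord p z = Fin (- l) \<and> - l < 0 \<and>
       padic_ord p z < Fin \<nu> \<longrightarrow>
       cw_mu p z \<nu> = 1 / (real p powi (\<nu> + 2 * l) + real p powi (\<nu> + 2 * l - 1))) \<and>
    (z = \<zero>\<^bsub>Qp p\<^esub> \<and> - \<nu> \<le> 0 \<longrightarrow>
       cw_mu p \<zero>\<^bsub>Qp p\<^esub> (- \<nu>) = 1 - 1 / (real p powi (\<nu> + 1) + real p powi \<nu>))"
proof -
  note p = assms(1)
  have freq: "\<exists>r. rat_ord p r = padic_ord p z \<and> (\<forall>L.
      cw_freq (\<lambda>q. Fin k \<le> rat_ord p (q - r)) \<longlonglongrightarrow> L \<longrightarrow> (\<lambda>n. cw_F p n z k) \<longlonglongrightarrow> L)" for k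
  proof -
    obtain r where r: "rat_ord p r = padic_ord p z"
      "\<And>q. Fin k \<le> padic_ord p (padic_of_rat p q \<ominus>\<^bsub>Qp p\<^esub> z) \<longleftrightarrow> Fin k \<le> rat_ord p (q - r)"
      using padic_rat_approx[OF assms, of k] by blast
    hence "(\<lambda>n. cw_F p (Suc n) z k) = cw_freq (\<lambda>q. Fin k \<le> rat_ord p (q - r))"
      by (simp add: cw_F_Suc fun_eq_iff)
    thus ?thesis using r(1) LIMSEQ_imp_Suc[of "\<lambda>n. cw_F p n z k"] by auto
  qed
  have mu: "cw_mu p z k = L" if "(\<lambda>n. cw_F p n z k) \<longlonglongrightarrow> L" for k L
    using that by (simp add: cw_mu_def limI)
  have integral: "(\<lambda>n. cw_F p n z k) \<longlonglongrightarrow> 1 / (real p powi k + real p powi (k - 1))"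
    if "Fin 0 \<le> padic_ord p z" "k \<ge> 1" for k
    using freq[of k] cw_freq_integral_tendsto[OF p _ that(2)] that(1) by metis
  have nonintegral: "(\<lambda>n. cw_F p n z k) \<longlonglongrightarrow>
      1 / (real p powi (k + 2 * l) + real p powi (k + 2 * l - 1))"
    if "padic_ord p z = Fin (- l)" "l > 0" "- l < k" for k l
    using freq[of k] cw_freq_nonintegral_tendsto[OF p _ that(2,3)] that(1) by metis
  have nonpos: "(\<lambda>n. cw_F p n z (- k)) \<longlonglongrightarrow> 1 - 1 / (real p powi (k + 1) + real p powi k)"
    if "Fin (- k) \<le> padic_ord p z" "k \<ge> 0" for k
    using freq[of "- k"] cw_freq_nonpos_tendsto[OF p _ that(2)] that(1) by metis
  have "convergent (\<lambda>n. cw_F p n z \<nu>)"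
  proof -
    \<comment> \<open>Convergence is claimed for every \<open>z\<close> and \<open>\<nu>\<close>, so
      these cases must be exhaustive: when \<open>\<nu> \<le> 0\<close>, either the valuation of
      \<open>z\<close> is at least \<open>\<nu>\<close> or it is negative and below
      \<open>\<nu>\<close>.\<close>
    consider "Fin 0 \<le> padic_ord p z" "\<nu> \<ge> 1" | "Fin (- (- \<nu>)) \<le> padic_ord p z" "- \<nu> \<ge> 0"
      | l where "padic_ord p z = Fin (- l)" "l > 0" "- l < \<nu>"
    proof (cases "padic_ord p z")
      case (Fin v)
      show thesis
      proof (cases "v < 0 \<and> v < \<nu>")
        case True
        thus thesis using that(3)[of "- v"] Fin by simp
      qed (use that Fin in \<open>cases "\<nu> \<ge> 1"; force\<close>)
    next
      case Minf
      \<comment> \<open>The valuation of \<open>z\<close> is attained by a rational, so it is never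
        \<open>Minf\<close>.\<close>
      thus thesis using freq[of 0] by (metis rat_ord_neq_Minf)
    qed (use that in force)
    thus ?thesis
      using integral nonintegral nonpos[of "- \<nu>"] unfolding convergent_def by cases (simp; blast)+
  qed
  moreover have "cw_mu p z \<nu> = 1 / (real p powi \<nu> + real p powi (\<nu> - 1))"
    if "z \<in> padic_integers p"
      "z \<noteq> \<zero>\<^bsub>Qp p\<^esub> \<and> padic_ord p z < Fin \<nu> \<or> z = \<zero>\<^bsub>Qp p\<^esub> \<and> \<nu> \<ge> 1"
  proof -
    have 0: "Fin 0 \<le> padic_ord p z" using that(1) by (simp add: padic_integers_def zero_extended_def)
    \<comment> \<open>For nonzero \<open>z\<close> this follows from 0 being at most the valuation,
      which is less than \<open>\<nu>\<close>.\<close>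
    hence "\<nu> \<ge> 1" using that(2) by (cases "padic_ord p z") auto
    thus ?thesis using mu integral 0 by blast
  qed
  moreover have "cw_mu p z \<nu> = 1 / (real p powi (\<nu> + 2 * l) + real p powi (\<nu> + 2 * l - 1))"
    if "padic_ord p z = Fin (- l)" "- l < 0" "padic_ord p z < Fin \<nu>" for l
    using mu nonintegral[of l \<nu>] that by simp
  moreover have "cw_mu p \<zero>\<^bsub>Qp p\<^esub> (- \<nu>) = 1 - 1 / (real p powi (\<nu> + 1) + real p powi \<nu>)"
    if "z = \<zero>\<^bsub>Qp p\<^esub>" "- \<nu> \<le> 0"
    using mu[OF nonpos, of \<nu>] that by simp
  ultimately show ?thesis by blast
qed

end
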